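(* Let $\underline a=(a_0,a_1,\dots,a_{N-1},a_{N-1}^*,\dots,a_1^*,a_0^* )\in\mathbb C^{2N}$. Let $\mathcal O_{\underline a}$ be the symplectic leaf containing $\underline a$ of the Poisson structure on $\mathbb C^{2N}$ given in the context, and let $s$, $i_k$, $r_{2k}$ be the data attached to $\underline a$ in the context. Then $$\dim\mathcal O_{\underline a}=\begin{cases}2\left[\frac{r_0}{2}\right]&\text{if } a_ia_i^*=0\text{ for all } i,\\[4pt]\displaystyle\sum_{k=0}^{l}\Big(2(i_{2k}-i_{2k+1})+2\left[\tfrac{r_{2k}+1}{2}\right]\Big)&\text{if } s=2l,\\[4pt]\displaystyle\sum_{k=0}^{l}2(i_{2k}-i_{2k+1})+\sum_{k=0}^{l+1}2\left[\tfrac{r_{2k}+1}{2}\right]&\text{if } s=2l+1.\end{cases}$$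
   Context: $[x]$ denotes the integer part of $x$. The Poisson structure on $\mathbb C^{2N}$ (coordinates $a_0,\dots,a_{N-1},a_0^*,\dots,a_{N-1}^*$) is $\{a_i,a_j\}=-a_ia_j$ for $i<j$; $\{a_i^*,a_j^*\}=a_i^*a_j^*$ for $i<j$; $\{a_i,a_j^*\}=-a_ia_j^*$ for $i\neq j$; $\{a_i,a_i^*\}=2\sum_{k>i}a_ka_k^*$. A symplectic leaf is a connected submanifold which is a maximal integral manifold of the distribution defined by the Hamiltonian vector fields; dimension means complex dimension. Data attached to $\underline a$. If $a_ia_i^*=0$ for all $i$, let $r_0$ be the number of non-zero coordinates of $\underline a$. Otherwise, let $i_0$ be the biggest index $i$ such that $a_ia_i^*\neq 0$, and let $r_0$ be the number of non-zero coordinates (starred or unstarred) having an index greater than $i_0$. Let $i_1$ be the biggest index among those $i<i_0$ for which $a_ia_i^*+a_{i_0}a_{i_0}^*=0$. Let $i_2$ be the biggest index among those $i<i_1$ for which $a_ia_i^*+a_{i_1}a_{i_1}^*+a_{i_0}a_{i_0}^*\neq0$, and let $r_2$ be the number of non-zero coordinates $a_i$ and $a_i^*$ with $i_2<i<i_1$. Continuing like this (that is, $i_k$ is the biggest $i<i_{k-1}$ for which $a_ia_i^*+a_{i_{k-1}}a_{i_{k-1}}^*+\dots+a_{i_0}a_{i_0}^*$ is zero if $k$ is odd, non-zero if $k$ is even, as long as such an index exists) one obtains a sequence of indices $0\le i_s<i_{s-1}<\dots<i_1<i_0\le N-1$; more generally $r_{2j}$ is the total number of non-zero coordinates $a_i$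 and $a_i^*$ with $i_{2j}<i<i_{2j-1}$. If $s=2l$, set $i_{2l+1}=0$. If $s=2l+1$, define $r_{2l+2}$ by letting $r_{2l+2}+1$ be the total number of non-zero coordinates (starred or unstarred) having an index smaller than $i_{2l+1}$.
   Formalization: The sums defining i_k (k≥1) run over all indices from i up to i_0, not only over i, i_{k-1},…,i_0; with the sums as written the formula fails, e.g. for N=4, a=(0,1,1,1), a^*=(0,1,1,-2) it gives 6 but the leaf has dimension 4. *)

theory Defs
  imports "HOL-Analysis.Analysis"
begin

text \<open>
  The space \<open>\<complex>\<^sup>2\<^sup>N\<close> is \<open>complex^('n + 'n)\<close> with \<open>N = CARD('n)\<close>.  Given an enumeration
  \<open>e\<close> of \<open>'n\<close> by \<open>0, \<dots>, N - 1\<close>, the coordinate with index \<open>Inl (e i)\<close> is \<open>a\<^sub>i\<close> and the one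
  with index \<open>Inr (e i)\<close> is \<open>a\<^sub>i\<^sup>*\<close>.  All linear algebra is over \<open>\<complex>\<close>: scalar
  multiplication is \<open>*s\<close>, and \<open>vec.subspace\<close>, \<open>vec.dim\<close> refer to it.
\<close>

section \<open>The Poisson structure and its Hamiltonian vector fields\<close>

text \<open>
  \<open>coord_bracket N a b u v\<close> is the value at the point \<open>(a, b)\<close> of the bracket of the coordinate
  functions labelled \<open>u\<close> and \<open>v\<close>, where \<open>Inl i\<close> labels \<open>a\<^sub>i\<close> and \<open>Inr i\<close> labels \<open>a\<^sub>i\<^sup>*\<close>.
\<close>

fun coord_bracket ::
  "nat \<Rightarrow> (nat \<Rightarrow> complex) \<Rightarrow> (nat \<Rightarrow> complex) \<Rightarrow> nat + nat \<Rightarrow> nat + nat \<Rightarrow> complex"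
where
  "coord_bracket N a b (Inl i) (Inl j) =
     (if i < j then - (a i * a j) else if j < i then a j * a i else 0)"
| "coord_bracket N a b (Inr i) (Inr j) =
     (if i < j then b i * b j else if j < i then - (b j * b i) else 0)"
| "coord_bracket N a b (Inl i) (Inr j) =
     (if i = j then 2 * (\<Sum>k\<in>{i<..<N}. a k * b k) else - (a i * b j))"
| "coord_bracket N a b (Inr i) (Inl j) =
     (if i = j then - (2 * (\<Sum>k\<in>{i<..<N}. a k * b k)) else a j * b i)"

definition holomorphic_fun :: "(complex^'m \<Rightarrow> complex) \<Rightarrow> bool" where
  "holomorphic_fun f \<longleftrightarrow>
     (\<forall>p. \<exists>L. Vector_Spaces.linear (*s) (*) L \<and> (f has_derivative L) (at p))"

definition cpartial :: "'m \<Rightarrow> (complex^'m \<Rightarrow> complex) \<Rightarrow> complex^'m \<Rightarrow> complex" where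
  "cpartial v f p = deriv (\<lambda>z. f (p + z *s axis v 1)) 0"

text \<open>The biderivation extending \<open>coord_bracket\<close> to all holomorphic functions.\<close>

definition poisson_bracket ::
  "(nat \<Rightarrow> 'n::finite) \<Rightarrow> (complex^('n + 'n) \<Rightarrow> complex) \<Rightarrow> (complex^('n + 'n) \<Rightarrow> complex) \<Rightarrow>
   complex^('n + 'n) \<Rightarrow> complex"
where
  "poisson_bracket e f g p =
     (\<Sum>u\<in>{..<CARD('n)} <+> {..<CARD('n)}. \<Sum>v\<in>{..<CARD('n)} <+> {..<CARD('n)}.
        coord_bracket CARD('n) (\<lambda>i. p $ Inl (e i)) (\<lambda>i. p $ Inr (e i)) u v
          * cpartial (map_sum e e u) f p * cpartial (map_sum e e v) g p)"

definition hamiltonian_field ::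
  "(nat \<Rightarrow> 'n::finite) \<Rightarrow> (complex^('n + 'n) \<Rightarrow> complex) \<Rightarrow> complex^('n + 'n) \<Rightarrow> complex^('n + 'n)"
where
  "hamiltonian_field e f p = (\<chi> v. poisson_bracket e f (\<lambda>q. q $ v) p)"

definition hamiltonian_distribution ::
  "(nat \<Rightarrow> 'n::finite) \<Rightarrow> complex^('n + 'n) \<Rightarrow> (complex^('n + 'n)) set"
where
  "hamiltonian_distribution e p = {hamiltonian_field e f p | f. holomorphic_fun f}"

section \<open>Complex submanifolds and symplectic leaves\<close>

text \<open>
  An (immersed) complex submanifold is a topology \<open>M\<close> whose points lie in the ambient space; the
  topology may be finer than the one induced by the ambient space.  Its local
  parametrizations \<open>\<phi>\<close> are holomorphic immersions, and homeomorphisms onto open subsets of \<open>M\<close>.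
  They are defined on relatively open subsets \<open>U\<close> of some \<open>d\<close>-dimensional complex subspace \<open>V\<close> of the
  ambient space; \<open>V\<close> serves only as a model of \<open>\<complex>\<^sup>d\<close>, which has no type of its own when \<open>d\<close> is a
  number (possibly \<open>0\<close>).  Holomorphy of the transition maps, the Hausdorff property and, for
  connected \<open>M\<close>, second countability follow.
\<close>

definition complex_linear :: "(complex^'m \<Rightarrow> complex^'m) \<Rightarrow> bool" where
  "complex_linear L \<longleftrightarrow> Vector_Spaces.linear (*s) (*s) L"

definition parametrization ::
  "nat \<Rightarrow> (complex^'m) topology \<Rightarrow> (complex^'m) set \<Rightarrow> (complex^'m) set \<Rightarrow>
   (complex^'m \<Rightarrow> complex^'m) \<Rightarrow> bool"
where
  "parametrization d M V U \<phi> \<longleftrightarrow>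
     vec.subspace V \<and> vec.dim V = d \<and> openin (top_of_set V) U \<and>
     openin M (\<phi> ` U) \<and> homeomorphic_map (top_of_set U) (subtopology M (\<phi> ` U)) \<phi> \<and>
     (\<forall>u\<in>U. \<exists>L. complex_linear L \<and> (\<phi> has_derivative L) (at u within U) \<and> inj_on L V)"

definition complex_submanifold :: "nat \<Rightarrow> (complex^'m) topology \<Rightarrow> bool" where
  "complex_submanifold d M \<longleftrightarrow>
     (\<forall>x\<in>topspace M. \<exists>V U \<phi>. parametrization d M V U \<phi> \<and> x \<in> \<phi> ` U)"

text \<open>
  \<open>S\<close> is the image of the differential of a parametrization around \<open>x\<close>; it does not depend on the
  parametrization.
\<close>

definition is_tangent_space ::
  "nat \<Rightarrow> (complex^'m) topology \<Rightarrow> complex^'m \<Rightarrow> (complex^'m) set \<Rightarrow> bool"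
where
  "is_tangent_space d M x S \<longleftrightarrow>
     (\<exists>V U \<phi> u L. parametrization d M V U \<phi> \<and> u \<in> U \<and> \<phi> u = x \<and>
        complex_linear L \<and> (\<phi> has_derivative L) (at u within U) \<and> S = L ` V)"

definition connected_integral_manifold ::
  "(nat \<Rightarrow> 'n::finite) \<Rightarrow> nat \<Rightarrow> (complex^('n + 'n)) topology \<Rightarrow> bool"
where
  "connected_integral_manifold e d M \<longleftrightarrow>
     complex_submanifold d M \<and> connected_space M \<and>
     (\<forall>x\<in>topspace M. is_tangent_space d M x (hamiltonian_distribution e x))"

text \<open>The symplectic leaves of complex dimension \<open>d\<close>.\<close>

definition symplectic_leaf ::
  "(nat \<Rightarrow> 'n::finite) \<Rightarrow> nat \<Rightarrow> (complex^('n + 'n)) topology \<Rightarrow> bool"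
where
  "symplectic_leaf e d M \<longleftrightarrow>
     connected_integral_manifold e d M \<and>
     (\<forall>d' M'. connected_integral_manifold e d' M' \<and> topspace M \<subseteq> topspace M'
        \<longrightarrow> topspace M' = topspace M)"

section \<open>The numerical data attached to a point\<close>

text \<open>
  In this section the point is \<open>(a, b)\<close>, with \<open>b i\<close> standing for \<open>a\<^sub>i\<^sup>*\<close>.
  The sums whose vanishing determines the indices \<open>i\<^sub>k\<close> are sums over \<^emph>\<open>all\<close> indices from
  \<open>i\<close> up to \<open>N - 1\<close> (equivalently up to \<open>i\<^sub>0\<close>).  If only the terms with indices
  \<open>i, i\<^bsub>k-1\<^esub>, \<dots>, i\<^sub>0\<close> were added, the dimension formula would fail: at \<open>N = 4\<close>,
  \<open>a = (0,1,1,1)\<close>, \<open>b = (0,1,1,-2)\<close> it would give \<open>6\<close>, but the Poisson tensor has rank \<open>4\<close>.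
\<close>

definition tail_sum :: "nat \<Rightarrow> (nat \<Rightarrow> complex) \<Rightarrow> (nat \<Rightarrow> complex) \<Rightarrow> nat \<Rightarrow> complex" where
  "tail_sum N a b i = (\<Sum>j\<in>{i..<N}. a j * b j)"

definition biggest :: "nat set \<Rightarrow> nat option" where
  "biggest A = (if A = {} then None else Some (Max A))"

text \<open>\<open>index_opt N a b k\<close> is \<open>Some i\<^sub>k\<close> as long as \<open>i\<^sub>k\<close> exists.\<close>

fun index_opt :: "nat \<Rightarrow> (nat \<Rightarrow> complex) \<Rightarrow> (nat \<Rightarrow> complex) \<Rightarrow> nat \<Rightarrow> nat option" where
  "index_opt N a b 0 = biggest {i. i < N \<and> a i * b i \<noteq> 0}"
| "index_opt N a b (Suc k) =
     (case index_opt N a b k of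
        None \<Rightarrow> None
      | Some m \<Rightarrow> biggest {i. i < m \<and> (tail_sum N a b i = 0 \<longleftrightarrow> odd (Suc k))})"

text \<open>
  Meaningful only if \<open>a\<^sub>i a\<^sub>i\<^sup>* \<noteq> 0\<close> for some \<open>i\<close>; the maximum exists since the \<open>i\<^sub>k\<close> decrease.
\<close>

definition last_step :: "nat \<Rightarrow> (nat \<Rightarrow> complex) \<Rightarrow> (nat \<Rightarrow> complex) \<Rightarrow> nat" where
  "last_step N a b = (GREATEST k. index_opt N a b k \<noteq> None)"

text \<open>The value \<open>0\<close> in the undefined case is the convention \<open>i\<^bsub>2l+1\<^esub> = 0\<close> for \<open>s = 2l\<close>.\<close>

definition index :: "nat \<Rightarrow> (nat \<Rightarrow> complex) \<Rightarrow> (nat \<Rightarrow> complex) \<Rightarrow> nat \<Rightarrow> nat" where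
  "index N a b k = (case index_opt N a b k of None \<Rightarrow> 0 | Some m \<Rightarrow> m)"

definition num_nonzero :: "(nat \<Rightarrow> complex) \<Rightarrow> (nat \<Rightarrow> complex) \<Rightarrow> nat set \<Rightarrow> nat" where
  "num_nonzero a b I = card {i \<in> I. a i \<noteq> 0} + card {i \<in> I. b i \<noteq> 0}"

text \<open>
  \<open>r_even N a b k\<close> is \<open>r\<^bsub>2k\<^esub>\<close>.  It is an integer because \<open>r\<^bsub>2l+2\<^esub> = -1\<close> is possible
  when \<open>s = 2l + 1\<close>.
\<close>

fun r_even :: "nat \<Rightarrow> (nat \<Rightarrow> complex) \<Rightarrow> (nat \<Rightarrow> complex) \<Rightarrow> nat \<Rightarrow> int" where
  "r_even N a b 0 =
     (if \<forall>i<N. a i * b i = 0 then int (num_nonzero a b {..<N})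
      else int (num_nonzero a b {index N a b 0<..<N}))"
| "r_even N a b (Suc k) =
     (if 2 * Suc k \<le> last_step N a b
      then int (num_nonzero a b {index N a b (2 * k + 2)<..<index N a b (2 * k + 1)})
      else int (num_nonzero a b {..<index N a b (2 * k + 1)}) - 1)"

end

theory Submission
  imports Defs
begin

text \<open>
  The dimension of a leaf is the rank of the Poisson matrix at any of its points.  Let \<open>\<Omega>\<^sub>i\<close> be the
  submatrix belonging to the coordinates with index at least \<open>i\<close>, let \<open>x\<^sub>i\<close> be the vector of these
  coordinates of the point, and let \<open>t\<^sub>i\<close> be the \<open>i\<close>-th tail sum.  Passing from \<open>\<Omega>\<^bsub>i+1\<^esub>\<close> to \<open>\<Omega>\<^sub>i\<close>
  borders the matrix by multiples \<open>a\<^sub>i x\<^bsub>i+1\<^esub>\<close> and \<open>- a\<^sub>i\<^sup>* x\<^bsub>i+1\<^esub>\<close> of one vector and by the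
  corner entry \<open>2 t\<^bsub>i+1\<^esub>\<close>, so the growth of the rank depends only on \<open>t\<^bsub>i+1\<^esub>\<close> and on whether
  \<open>x\<^bsub>i+1\<^esub>\<close> lies in the image of \<open>\<Omega>\<^bsub>i+1\<^esub>\<close>.  The rank grows by \<open>2\<close> if \<open>t\<^bsub>i+1\<^esub> \<noteq> 0\<close>.  If
  \<open>t\<^bsub>i+1\<^esub> = 0\<close>, it grows, by \<open>2\<close>, iff \<open>x\<^bsub>i+1\<^esub>\<close> is not in the image and \<open>a\<^sub>i\<close>, \<open>a\<^sub>i\<^sup>*\<close> are not both
  zero.  Where the tail sums vanish, each non-zero coordinate toggles membership of \<open>x\<^sub>i\<close> in the image
  of \<open>\<Omega>\<^sub>i\<close>, which accounts for the integer parts.  Where they do not vanish, \<open>x\<^sub>i\<close> stays outside, and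
  it enters the image at the first index at which the tail sum vanishes again.
\<close>

section \<open>Tangent spaces\<close>

lemma complex_linear_dim_image:
  fixes L :: "complex^'m \<Rightarrow> complex^'m"
  assumes "complex_linear L" "vec.subspace V" "inj_on L V"
  shows "vec.dim (L ` V) = vec.dim V"
  using assms vec.dim_image_eq[of L V] unfolding complex_linear_def
  by (simp only: vec.span_eq_iff[THEN iffD2])

lemma scaleR_eq_vector_scale: "t *\<^sub>R (v :: complex^'m) = complex_of_real t *s v"
  unfolding vec_eq_iff vector_scaleR_component by (simp add: scaleR_conv_of_real)

text \<open>As \<open>U\<close> is open only in \<open>V\<close>, a derivative within
  \<open>U\<close> is determined only along \<open>V\<close>. Restricting \<open>\<phi>\<close> to
  the real line through \<open>u\<close> in direction \<open>v\<close> gives an ordinary derivative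
  at an interior point, which is unique.\<close>

lemma derivative_unique_within_subspace:
  fixes \<phi> :: "complex^'m \<Rightarrow> complex^'m"
  assumes V: "vec.subspace V" and U: "openin (top_of_set V) U" and u: "u \<in> U" and v: "v \<in> V"
    and L: "(\<phi> has_derivative L) (at u within U)" "(\<phi> has_derivative L') (at u within U)"
  shows "L v = L' v"
proof -
  obtain T where T: "open T" "U = V \<inter> T"
    using U by (auto simp: openin_open)
  define g where "g t = u + t *\<^sub>R v" for t
  define I where "I = g -` T"
  have g: "(g has_derivative (\<lambda>t. t *\<^sub>R v)) (at t within I)" for t
    unfolding g_def by (auto intro!: derivative_eq_intros)
  have "continuous_on UNIV g"
    unfolding g_def by (intro continuous_intros)
  then have I: "open I"
    unfolding I_def using T(1) by (simp add: continuous_on_open_vimage)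
  have gI: "g ` I \<subseteq> U"
    using u v V T unfolding g_def I_def
    by (auto simp: scaleR_eq_vector_scale intro!: vec.subspace_add vec.subspace_scale)
  have g0: "g 0 = u" and I0: "0 \<in> I"
    using u T by (auto simp: g_def I_def)
  have D: "(\<phi> \<circ> g has_derivative (\<lambda>t. K (t *\<^sub>R v))) (at 0)"
    if "(\<phi> has_derivative K) (at u within U)" for K
  proof -
    have "(\<phi> has_derivative K) (at (g 0) within g ` I)"
      using that gI g0 has_derivative_subset by metis
    then have "(\<phi> \<circ> g has_derivative K \<circ> (\<lambda>t. t *\<^sub>R v)) (at 0 within I)"
      using diff_chain_within g by blast
    then show ?thesis
      unfolding o_def at_within_open[OF I0 I] .
  qed
  have "(\<lambda>t. L (t *\<^sub>R v)) = (\<lambda>t. L' (t *\<^sub>R v))"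
    using has_derivative_unique D L by blast
  from fun_cong[OF this, of 1] show ?thesis
    by simp
qed

text \<open>\<open>is_tangent_space\<close> does not say that its \<open>L\<close> is injective. The
  parametrization supplies some injective derivative \<open>L'\<close>, and both agree on
  \<open>V\<close>.\<close>

lemma dim_tangent_space:
  assumes "is_tangent_space d M x S"
  shows "vec.dim S = d"
proof -
  obtain V U \<phi> u L where P: "parametrization d M V U \<phi>" and u: "u \<in> U"
    and L: "complex_linear L" "(\<phi> has_derivative L) (at u within U)" "S = L ` V"
    using assms unfolding is_tangent_space_def by blast
  have V: "vec.subspace V" "vec.dim V = d" "openin (top_of_set V) U"
    using P by (auto simp: parametrization_def)
  obtain L' where L': "(\<phi> has_derivative L') (at u within U)" "inj_on L' V"
    using P u unfolding parametrization_def by blast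
  have "inj_on L V"
    using derivative_unique_within_subspace[OF V(1,3) u _ L(2) L'(1)] L'(2)
    by (simp add: inj_on_def)
  then show ?thesis
    using complex_linear_dim_image L V by metis
qed

section \<open>Bordered skew-symmetric operators\<close>

text \<open>Without conjugation, because the Poisson matrix is skew for this bilinear form and not
  for a Hermitian one.\<close>

definition bdot :: "complex^'m \<Rightarrow> complex^'m \<Rightarrow> complex" where
  "bdot x y = (\<Sum>v\<in>UNIV. x $ v * y $ v)"

lemma bdot_commute: "bdot x y = bdot y x"
  by (simp add: bdot_def mult.commute)

lemma bdot_simps [simp]:
  "bdot x 0 = 0" "bdot 0 x = 0"
  "bdot x (y + z) = bdot x y + bdot x z" "bdot (y + z) x = bdot y x + bdot z x"
  "bdot x (y - z) = bdot x y - bdot x z"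
  "bdot x (c *s y) = c * bdot x y" "bdot (c *s y) x = c * bdot y x"
  by (simp_all add: bdot_def sum.distrib sum_subtractf sum_distrib_left algebra_simps)

lemma bdot_axis [simp]: "bdot x (axis v c) = x $ v * c" "bdot (axis v c) x = c * x $ v"
  by (simp_all add: bdot_def axis_def if_distrib[of "(*) _"] if_distrib[of "\<lambda>x. x * _"] cong: if_cong)

lemma bdot_sum [simp]:
  "bdot x (sum f A) = (\<Sum>i\<in>A. bdot x (f i))" "bdot (sum f A) x = (\<Sum>i\<in>A. bdot (f i) x)"
  by (induction A rule: infinite_finite_induct) auto

lemma vec_axis_same [simp]: "axis v c $ v = c"
  by (simp add: axis_def)

lemma vec_axis_other: "v \<noteq> w \<Longrightarrow> axis v c $ w = (0::'a::zero)"
  by (simp add: axis_def)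

lemma vec_axis_zero [simp]: "axis v (0::'a::zero) = 0"
  by (simp add: vec_eq_iff axis_def)

definition solvable :: "(complex^'m \<Rightarrow> complex^'m) \<Rightarrow> complex^'m \<Rightarrow> bool" where
  "solvable A x \<longleftrightarrow> (\<exists>z. A z = x)"

text \<open>
  For skew \<open>A\<close> this is the negation of \<open>solvable\<close>, since the image is the orthogonal complement of
  the kernel.  Carrying explicit witnesses for both makes that duality unnecessary.
\<close>

definition obstructed :: "(complex^'m \<Rightarrow> complex^'m) \<Rightarrow> complex^'m \<Rightarrow> bool" where
  "obstructed A x \<longleftrightarrow> (\<exists>k. A k = 0 \<and> bdot x k \<noteq> 0)"

text \<open>One bordering step: \<open>u\<close> and \<open>v\<close> are the two new coordinates,
  \<open>\<alpha>\<close> and \<open>\<beta>\<close> their values at the point, \<open>t\<close> the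
  tail sum of the larger indices. Both matrices act on the same space, with \<open>A'\<close> padded
  by zero rows and columns at \<open>u\<close> and \<open>v\<close>.\<close>

locale skew_extension =
  fixes A A' :: "complex^'m \<Rightarrow> complex^'m" and x x' :: "complex^'m" and u v :: 'm
    and \<alpha> \<beta> t :: complex
  assumes lin: "Vector_Spaces.linear (*s) (*s) A'"
    and neq: "u \<noteq> v"
    and x'_zero: "x' $ u = 0" "x' $ v = 0"
    and A'_zero: "A' y $ u = 0" "A' y $ v = 0"
    and A'_cong: "(\<And>w. w \<noteq> u \<Longrightarrow> w \<noteq> v \<Longrightarrow> y $ w = z $ w) \<Longrightarrow> A' y = A' z"
    and skew: "bdot z (A' y) = - bdot (A' z) y"
    and x_eq: "x = x' + axis u \<alpha> + axis v \<beta>"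
    and A_eq: "A y = A' y + (\<alpha> * y $ u - \<beta> * y $ v) *s x'
      + axis u (2 * t * y $ v - \<alpha> * bdot x' y) + axis v (\<beta> * bdot x' y - 2 * t * y $ u)"
begin

text \<open>Neither \<open>A'\<close> nor \<open>bdot x'\<close> sees the entries at
  \<open>u\<close> and \<open>v\<close>, so these are free parameters in the search for preimages
  and kernel vectors.\<close>

definition upd :: "complex^'m \<Rightarrow> complex \<Rightarrow> complex \<Rightarrow> complex^'m" where
  "upd y c d = (\<chi> w. if w = u then c else if w = v then d else y $ w)"

lemma upd_nth [simp]: "upd y c d $ u = c" "upd y c d $ v = d"
  using neq by (auto simp: upd_def)

lemma A'_upd [simp]: "A' (upd y c d) = A' y"
  by (rule A'_cong) (simp add: upd_def)

lemma bdot_upd [simp]: "bdot x' (upd y c d) = bdot x' y"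
  unfolding bdot_def by (rule sum.cong) (auto simp: upd_def x'_zero)

lemma A_upd: "A (upd y c d) = A' y + (\<alpha> * c - \<beta> * d) *s x'
      + axis u (2 * t * d - \<alpha> * bdot x' y) + axis v (\<beta> * bdot x' y - 2 * t * c)"
  by (simp add: A_eq)

lemma bdot_x_upd: "bdot x (upd y c d) = bdot x' y + \<alpha> * c + \<beta> * d"
  by (simp add: x_eq)

lemmas A'_linear [simp] = vec.linear_0[OF lin] vec.linear_add[OF lin] vec.linear_diff[OF lin] vec.linear_scale[OF lin]

lemma x'_isotropic: "A' z = x' \<Longrightarrow> bdot x' z = 0"
  using skew[of z z] bdot_commute[of z "A' z"] by simp

lemma subspace_range': "vec.subspace (range A')"
  using vec.linear_subspace_image[OF lin vec.subspace_UNIV] by simp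

lemma span_range' [simp]: "vec.span (range A') = range A'"
  using subspace_range' by simp

lemma in_span_insert_range':
  "w \<in> vec.span (insert f (insert g (range A'))) \<longleftrightarrow> (\<exists>y c d. w = A' y + c *s f + d *s g)"
  by (auto simp: vec.span_insert algebra_simps eq_diff_eq image_iff)

lemma dim_range_nonzero:
  assumes t: "t \<noteq> 0"
  shows "vec.dim (range A) = vec.dim (range A') + 2"
proof -
  \<comment> \<open>If \<open>A y\<close> has entries \<open>c\<close> and \<open>d\<close> at
    \<open>u\<close> and \<open>v\<close>, solving for \<open>y $ u\<close> and \<open>y $ v\<close>
    turns the coefficient of \<open>x'\<close> into
    \<open>- (\<beta> * c + \<alpha> * d) / (2 * t)\<close>; the terms in \<open>bdot x' y\<close>
    cancel. Hence \<open>f\<close> and \<open>g\<close> are the new directions.\<close>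
  define f where "f = axis u 1 + (- \<beta> / (2 * t)) *s x'"
  define g where "g = axis v 1 + (- \<alpha> / (2 * t)) *s x'"
  have "A y \<in> vec.span (insert f (insert g (range A')))" for y
  proof -
    have "A y = A' y + (2 * t * y $ v - \<alpha> * bdot x' y) *s f
        + (\<beta> * bdot x' y - 2 * t * y $ u) *s g"
      using t by (simp add: A_eq f_def g_def vec_eq_iff axis_def field_simps)
    then show ?thesis
      unfolding in_span_insert_range' by blast
  qed
  moreover have "w \<in> range A" if w: "w \<in> vec.span (insert f (insert g (range A')))" for w
  proof -
    obtain c d y where w: "w = A' y + c *s f + d *s g"
      using w unfolding in_span_insert_range' by blast
    have "A (upd y ((\<beta> * bdot x' y - d) / (2 * t)) ((c + \<alpha> * bdot x' y) / (2 * t))) = w"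
      using t unfolding w by (simp add: A_upd f_def g_def vec_eq_iff axis_def field_simps)
    then show ?thesis
      by blast
  qed
  ultimately have R: "range A = vec.span (insert f (insert g (range A')))"
    by blast
  have g: "g \<notin> vec.span (range A')"
  proof
    assume "g \<in> vec.span (range A')"
    then obtain y where "g = A' y"
      by auto
    from arg_cong[OF this, of "\<lambda>w. w $ v"] show False
      by (simp add: g_def A'_zero x'_zero)
  qed
  have f: "f \<notin> vec.span (insert g (range A'))"
  proof
    assume "f \<in> vec.span (insert g (range A'))"
    then obtain c y where "f = A' y + c *s g"
      by (auto simp: vec.span_insert algebra_simps eq_diff_eq)
    from arg_cong[OF this, of "\<lambda>w. w $ u"] show False
      using neq by (simp add: f_def g_def A'_zero x'_zero vec_axis_other)
  qed
  show ?thesis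
    using f g by (simp add: R vec.dim_insert)
qed

text \<open>Matching the two new entries of \<open>x\<close> by a vector supported on
  \<open>u\<close> and \<open>v\<close> gives \<open>x'\<close> the coefficient
  \<open>- \<alpha> * \<beta> / t\<close>, which is \<open>1\<close> because the new tail sum
  vanishes.\<close>

lemma solvable_nonzero:
  assumes "t \<noteq> 0" "t + \<alpha> * \<beta> = 0"
  shows "solvable A x"
proof -
  have "\<alpha> * \<beta> = - t"
    using assms(2) by (simp add: eq_neg_iff_add_eq_0 add.commute)
  then have "A (upd 0 (- \<beta> / (2 * t)) (\<alpha> / (2 * t))) = x"
    using assms(1) by (simp add: A_upd x_eq vec_eq_iff field_simps)
  then show ?thesis
    unfolding solvable_def by blast
qed

text \<open>The border entries added to \<open>k\<close> cancel the rows \<open>u\<close> and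
  \<open>v\<close>, and their contributions to the coefficient of \<open>x'\<close> cancel each
  other. The pairing gets multiplied by the ratio of the new tail sum to the old one.\<close>

lemma obstructed_nonzero:
  assumes t: "t \<noteq> 0" "t + \<alpha> * \<beta> \<noteq> 0" and "obstructed A' x'"
  shows "obstructed A x"
proof -
  obtain k where k: "A' k = 0" "bdot x' k \<noteq> 0"
    using \<open>obstructed A' x'\<close> unfolding obstructed_def by blast
  define y where "y = upd k (\<beta> * bdot x' k / (2 * t)) (\<alpha> * bdot x' k / (2 * t))"
  have "A y = 0"
    using t by (simp add: y_def A_upd k vec_eq_iff)
  moreover have "bdot x y = bdot x' k * ((t + \<alpha> * \<beta>) / t)"
    using t by (simp add: y_def bdot_x_upd field_simps)
  ultimately show ?thesis
    unfolding obstructed_def using t k by (metis divide_eq_0_iff mult_eq_0_iff)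
qed

lemma trivial_step:
  assumes "t = 0" "\<alpha> = 0" "\<beta> = 0"
  shows "vec.dim (range A) = vec.dim (range A')" "solvable A' x' \<Longrightarrow> solvable A x" "obstructed A' x' \<Longrightarrow> obstructed A x"
proof -
  have "A y = A' y" for y
    using assms by (simp add: A_eq vec_eq_iff)
  then have "A = A'" ..
  moreover have "x = x'"
    using assms by (simp add: x_eq vec_eq_iff)
  ultimately show "vec.dim (range A) = vec.dim (range A')" "solvable A' x' \<Longrightarrow> solvable A x"
    "obstructed A' x' \<Longrightarrow> obstructed A x"
    by simp_all
qed

text \<open>The column \<open>x'\<close> adds nothing to the image, and the new rows are functions
  of \<open>A' y\<close>, since \<open>bdot x' y = - bdot z (A' y)\<close> by skewness. So the new
  image is the graph \<open>f\<close> of a linear map on the old one.\<close>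

lemma dim_range_solvable:
  assumes t: "t = 0" and "solvable A' x'"
  shows "vec.dim (range A) = vec.dim (range A')"
proof -
  obtain z where z: "A' z = x'"
    using \<open>solvable A' x'\<close> unfolding solvable_def by blast
  define w where "w = axis u (- \<alpha>) + axis v \<beta>"
  define f where "f y = y + (- bdot z y) *s w" for y
  have f_A': "f (A' y) = A' y + bdot x' y *s w" for y
    by (simp add: f_def skew z)
  have "A y \<in> f ` range A'" for y
  proof -
    \<comment> \<open>Adding a multiple of \<open>z\<close> produces the required multiple of
      \<open>x'\<close>; it leaves \<open>bdot x' y\<close> unchanged because \<open>x'\<close> is
      isotropic.\<close>
    have "A y = f (A' (y + (\<alpha> * y $ u - \<beta> * y $ v) *s z))"
      using t z x'_isotropic[OF z] unfolding f_A'
      by (simp add: A_eq w_def vec_eq_iff axis_def)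
    then show ?thesis
      by blast
  qed
  moreover have "f (A' y) \<in> range A" for y
  proof -
    have "f (A' y) = A (upd y 0 0)"
      using t unfolding f_A' by (simp add: A_upd w_def vec_eq_iff axis_def)
    then show ?thesis
      by blast
  qed
  ultimately have R: "range A = f ` range A'"
    by blast
  have "inj_on f (range A')"
  proof (rule inj_onI)
    fix y y' assume y: "y \<in> range A'" "y' \<in> range A'" "f y = f y'"
    have "y $ i = y' $ i" for i
    proof (cases "i = u \<or> i = v")
      case True
      then show ?thesis
        using y(1,2) A'_zero by auto
    next
      case False
      then show ?thesis
        using arg_cong[OF y(3), of "\<lambda>y. y $ i"] by (simp add: f_def w_def axis_def)
    qed
    then show "y = y'"
      by (simp add: vec_eq_iff)
  qed
  moreover have "complex_linear f"
    unfolding complex_linear_def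
    by unfold_locales (simp_all add: f_def vec_eq_iff algebra_simps)
  ultimately show ?thesis
    using complex_linear_dim_image subspace_range' R by metis
qed

text \<open>Here \<open>x'\<close> lies outside the old image, and \<open>k\<close> makes the value
  of \<open>bdot x' y\<close> independent of \<open>A' y\<close>. So the column \<open>x'\<close>
  and the row direction \<open>w\<close> each add one dimension.\<close>

lemma dim_range_obstructed:
  assumes t: "t = 0" and ab: "\<alpha> \<noteq> 0 \<or> \<beta> \<noteq> 0" and "obstructed A' x'"
  shows "vec.dim (range A) = vec.dim (range A') + 2"
proof -
  obtain k where k: "A' k = 0" "bdot x' k \<noteq> 0"
    using \<open>obstructed A' x'\<close> unfolding obstructed_def by blast
  define w where "w = axis u (- \<alpha>) + axis v \<beta>"
  have A: "A y = A' y + (\<alpha> * y $ u - \<beta> * y $ v) *s x' + bdot x' y *s w" for y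
    using t by (simp add: A_eq w_def vec_eq_iff axis_def)
  have "A y \<in> vec.span (insert w (insert x' (range A')))" for y
    unfolding in_span_insert_range' using A[of y]
    by (metis add.assoc add.commute)
  moreover have "f \<in> range A" if f: "f \<in> vec.span (insert w (insert x' (range A')))" for f
  proof -
    obtain c d y where f: "f = A' y + c *s w + d *s x'"
      using f unfolding in_span_insert_range' by blast
    obtain c1 c2 where c: "\<alpha> * c1 - \<beta> * c2 = d"
    proof (cases "\<alpha> = 0")
      case True
      then show ?thesis
        using ab that[of 0 "- d / \<beta>"] by simp
    next
      case False
      then show ?thesis
        using that[of "d / \<alpha>" 0] by simp
    qed
    \<comment> \<open>The multiple of \<open>k\<close> moves \<open>bdot x' y\<close> to
      \<open>c\<close> without changing \<open>A' y\<close>; \<open>c1\<close> and \<open>c2\<close>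
      give \<open>x'\<close> the coefficient \<open>d\<close>.\<close>
    have "A (upd (y + ((c - bdot x' y) / bdot x' k) *s k) c1 c2) = f"
      using k by (simp add: A f c vec_eq_iff field_simps)
    then show ?thesis
      by blast
  qed
  ultimately have R: "range A = vec.span (insert w (insert x' (range A')))"
    by blast
  have x': "x' \<notin> vec.span (range A')"
  proof
    assume "x' \<in> vec.span (range A')"
    then obtain z where "x' = A' z"
      by auto
    then have "bdot x' k = 0"
      using skew[of z k] k by simp
    with k show False
      by simp
  qed
  have w: "w \<notin> vec.span (insert x' (range A'))"
  proof
    assume "w \<in> vec.span (insert x' (range A'))"
    then obtain c y where *: "w = A' y + c *s x'"
      by (auto simp: vec.span_insert algebra_simps eq_diff_eq)
    show False
      using arg_cong[OF *, of "\<lambda>w. w $ u"] arg_cong[OF *, of "\<lambda>w. w $ v"] ab neq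
      by (simp add: w_def A'_zero x'_zero vec_axis_other)
  qed
  show ?thesis
    using x' w by (simp add: R vec.dim_insert)
qed

text \<open>The multiple of \<open>z\<close> cancels the \<open>x'\<close> term caused by the border
  entries \<open>c\<close> and \<open>d\<close>. As \<open>x'\<close> is isotropic, the new rows
  vanish and the pairing with \<open>x\<close> is just
  \<open>\<alpha> * c + \<beta> * d\<close>.\<close>

lemma obstructed_if_solvable:
  assumes t: "t = 0" and ab: "\<alpha> \<noteq> 0 \<or> \<beta> \<noteq> 0" and "solvable A' x'"
  shows "obstructed A x"
proof -
  obtain z where z: "A' z = x'"
    using \<open>solvable A' x'\<close> unfolding solvable_def by blast
  obtain c d where c: "\<alpha> * c + \<beta> * d \<noteq> 0"
    using ab by (metis add.right_neutral add.left_neutral mult.right_neutral mult_zero_right)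
  define y where "y = upd ((\<beta> * d - \<alpha> * c) *s z) c d"
  have "A y = 0" "bdot x y \<noteq> 0"
    using t c by (simp_all add: y_def A_upd bdot_x_upd z x'_isotropic[OF z] vec_eq_iff algebra_simps)
  then show ?thesis
    unfolding obstructed_def by blast
qed

text \<open>The border entries give \<open>x'\<close> the coefficient \<open>1\<close>, and the
  multiple of \<open>k\<close> sets the rows \<open>u\<close> and \<open>v\<close>. These rows are
  \<open>- \<alpha>\<close> and \<open>\<beta>\<close> times one common number, so the right values
  are reached when exactly one of the two is non-zero.\<close>

lemma solvable_if_obstructed:
  assumes t: "t = 0" and ab: "\<alpha> \<noteq> 0 \<longleftrightarrow> \<beta> = 0" and "obstructed A' x'"
  shows "solvable A x"
proof -
  obtain k where k: "A' k = 0" "bdot x' k \<noteq> 0"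
    using \<open>obstructed A' x'\<close> unfolding obstructed_def by blast
  define s where "s = (if \<beta> = 0 then - 1 else 1 :: complex)"
  \<comment> \<open>For \<open>\<beta> = 0\<close> the last entry is only ever multiplied by zero in
    \<open>A y\<close>, so the division by zero is harmless.\<close>
  define y where "y = upd ((s / bdot x' k) *s k) (if \<beta> = 0 then 1 / \<alpha> else 0) (- 1 / \<beta>)"
  have "A y = x"
    using t ab k by (auto simp add: y_def A_upd x_eq s_def vec_eq_iff)
  then show ?thesis
    unfolding solvable_def by blast
qed

text \<open>The kernel vector lives on the two new coordinates alone, so the outcome does not depend
  on the status of \<open>x'\<close>. This is the step at which the tail sum leaves zero.\<close>

lemma obstructed_both:
  assumes "t = 0" "\<alpha> \<noteq> 0" "\<beta> \<noteq> 0"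
  shows "obstructed A x"
proof -
  have "A (upd 0 \<beta> \<alpha>) = 0" "bdot x (upd 0 \<beta> \<alpha>) \<noteq> 0"
    using assms by (simp_all add: A_upd bdot_x_upd vec_eq_iff)
  then show ?thesis
    unfolding obstructed_def by blast
qed

end

section \<open>The Poisson matrix on the coordinates of large index\<close>

definition labels :: "nat \<Rightarrow> nat \<Rightarrow> (nat + nat) set" where
  "labels N i = {i..<N} <+> {i..<N}"

lemma finite_labels [simp]: "finite (labels N i)"
  by (simp add: labels_def)

lemma labels_self [simp]: "labels N N = {}"
  by (auto simp: labels_def)

lemma Inl_in_labels [simp]: "Inl j \<in> labels N i \<longleftrightarrow> i \<le> j \<and> j < N"
  and Inr_in_labels [simp]: "Inr j \<in> labels N i \<longleftrightarrow> i \<le> j \<and> j < N"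
  by (auto simp: labels_def)

lemma sum_labels:
  assumes "i < N"
  shows "sum f (labels N i) = sum f (labels N (Suc i)) + f (Inl i) + f (Inr i)"
proof -
  have "{i..<N} = insert i {Suc i..<N}"
    using assms by auto
  then have "labels N i = insert (Inl i) (insert (Inr i) (labels N (Suc i)))"
    by (auto simp: labels_def)
  then show ?thesis
    by (simp add: algebra_simps)
qed

lemma coord_bracket_antisym: "coord_bracket N a b w u = - coord_bracket N a b u w"
  by (cases w; cases u) auto

definition coord :: "(nat \<Rightarrow> complex) \<Rightarrow> (nat \<Rightarrow> complex) \<Rightarrow> nat + nat \<Rightarrow> complex" where
  "coord a b = case_sum a b"

definition poisson_op ::
  "(nat \<Rightarrow> 'n::finite) \<Rightarrow> nat \<Rightarrow> (nat \<Rightarrow> complex) \<Rightarrow> (nat \<Rightarrow> complex) \<Rightarrow> nat \<Rightarrow>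
   complex^('n + 'n) \<Rightarrow> complex^('n + 'n)"
where
  "poisson_op e N a b i y =
     (\<Sum>w\<in>labels N i. axis (map_sum e e w)
        (\<Sum>u\<in>labels N i. coord_bracket N a b w u * y $ map_sum e e u))"

definition tail_point ::
  "(nat \<Rightarrow> 'n::finite) \<Rightarrow> nat \<Rightarrow> (nat \<Rightarrow> complex) \<Rightarrow> (nat \<Rightarrow> complex) \<Rightarrow> nat \<Rightarrow> complex^('n + 'n)"
where
  "tail_point e N a b i = (\<Sum>w\<in>labels N i. axis (map_sum e e w) (coord a b w))"

lemma axis_add: "axis v (c + d) = axis v c + axis v (d::complex)"
  by (simp add: vec_eq_iff axis_def)

lemma scale_axis: "c *s axis v d = axis v (c * (d::complex))"
  by (simp add: vec_eq_iff axis_def)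

lemma vec_sum_axis_zero:
  "(\<And>w. w \<in> W \<Longrightarrow> m w \<noteq> v) \<Longrightarrow> (\<Sum>w\<in>W. axis (m w) (c w)) $ v = (0::complex)"
  by (simp add: vec_axis_other)

lemma map_sum_notin_labels:
  assumes "inj_on e {..<N}" "i < N" "w \<in> labels N (Suc i)"
  shows "map_sum e e w \<noteq> Inl (e i)" "map_sum e e w \<noteq> Inr (e i)"
  using assms by (cases w; auto dest: inj_onD)+

text \<open>The bracket of a coordinate of index \<open>i\<close> with one of larger index is plus
  or minus their product, with a sign that depends only on whether the one of index \<open>i\<close>
  is starred. Hence both border columns are multiples of \<open>x'\<close>.\<close>

lemma poisson_op_Suc:
  fixes e :: "nat \<Rightarrow> 'n::finite" and a b :: "nat \<Rightarrow> complex"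
  assumes i: "i < N"
  defines "x' \<equiv> tail_point e N a b (Suc i)"
  shows "poisson_op e N a b i y = poisson_op e N a b (Suc i) y
    + (a i * y $ Inl (e i) - b i * y $ Inr (e i)) *s x'
    + axis (Inl (e i)) (2 * tail_sum N a b (Suc i) * y $ Inr (e i) - a i * bdot x' y)
    + axis (Inr (e i)) (b i * bdot x' y - 2 * tail_sum N a b (Suc i) * y $ Inl (e i))"
proof -
  let ?W = "labels N (Suc i)" and ?m = "map_sum e e"
  let ?B = "coord_bracket N a b"
  have B: "?B w (Inl i) = a i * coord a b w" "?B w (Inr i) = - b i * coord a b w"
    "?B (Inl i) w = - a i * coord a b w" "?B (Inr i) w = b i * coord a b w" if "w \<in> ?W" for w
    using that by (cases w; simp add: coord_def)+
  have T: "(\<Sum>k\<in>{i<..<N}. a k * b k) = tail_sum N a b (Suc i)"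
    by (simp add: tail_sum_def atLeastSucLessThan_greaterThanLessThan)
  have q: "bdot x' y = (\<Sum>u\<in>?W. coord a b u * y $ ?m u)"
    by (simp add: x'_def tail_point_def)
  have "(\<Sum>w\<in>?W. axis (?m w) (\<Sum>u\<in>labels N i. ?B w u * y $ ?m u)) =
    (\<Sum>w\<in>?W. axis (?m w) (\<Sum>u\<in>?W. ?B w u * y $ ?m u)
       + (a i * y $ Inl (e i) - b i * y $ Inr (e i)) *s axis (?m w) (coord a b w))"
    unfolding sum_labels[OF i] scale_axis axis_add[symmetric]
    by (intro sum.cong refl arg_cong2[of _ _ _ _ axis]) (simp add: B algebra_simps)
  also have "\<dots> = poisson_op e N a b (Suc i) y + (a i * y $ Inl (e i) - b i * y $ Inr (e i)) *s x'"
    by (simp only: sum.distrib poisson_op_def x'_def tail_point_def vec.scale_sum_right)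
  finally have 1: "(\<Sum>w\<in>?W. axis (?m w) (\<Sum>u\<in>labels N i. ?B w u * y $ ?m u)) = \<dots>" .
  have 2: "(\<Sum>u\<in>labels N i. ?B (Inl i) u * y $ ?m u)
    = 2 * tail_sum N a b (Suc i) * y $ Inr (e i) - a i * bdot x' y"
    unfolding sum_labels[OF i] q sum_distrib_left
    by (simp add: B T sum_negf[symmetric] mult.assoc cong: sum.cong)
  have 3: "(\<Sum>u\<in>labels N i. ?B (Inr i) u * y $ ?m u)
    = b i * bdot x' y - 2 * tail_sum N a b (Suc i) * y $ Inl (e i)"
    unfolding sum_labels[OF i] q sum_distrib_left
    by (simp add: B T mult.assoc cong: sum.cong)
  show ?thesis
    \<comment> \<open>The pattern for \<open>f\<close> confines the splitting to the outer
      sum.\<close>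
    unfolding poisson_op_def[of e N a b i] sum_labels[OF i, where f = "\<lambda>w. axis (?m w) (_ w)"] 1 2 3
    by (simp add: 2 3)
qed

lemma poisson_op_skew:
  "bdot z (poisson_op e N a b i y) = - bdot (poisson_op e N a b i z) y"
proof -
  let ?m = "map_sum e e" and ?W = "labels N i"
  have "bdot z (poisson_op e N a b i y)
    = (\<Sum>w\<in>?W. \<Sum>u\<in>?W. z $ ?m w * (coord_bracket N a b w u * y $ ?m u))"
    by (simp add: poisson_op_def sum_distrib_left)
  also have "\<dots> = (\<Sum>u\<in>?W. \<Sum>w\<in>?W. z $ ?m w * (coord_bracket N a b w u * y $ ?m u))"
    by (rule sum.swap)
  also have "\<dots> = (\<Sum>u\<in>?W. \<Sum>w\<in>?W. - (coord_bracket N a b u w * z $ ?m w * y $ ?m u))"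
    by (subst coord_bracket_antisym) (simp add: algebra_simps)
  also have "\<dots> = - bdot (poisson_op e N a b i z) y"
    by (simp add: poisson_op_def sum_distrib_right sum_negf)
  finally show ?thesis .
qed

lemma poisson_op_linear: "Vector_Spaces.linear (*s) (*s) (poisson_op e N a b i)"
  by unfold_locales
    (simp_all add: poisson_op_def algebra_simps sum.distrib axis_add vec.scale_sum_right scale_axis
      sum_distrib_left)

lemma skew_extension_poisson_op:
  assumes "inj_on e {..<N}" "i < N"
  shows "skew_extension (poisson_op e N a b i) (poisson_op e N a b (Suc i))
    (tail_point e N a b i) (tail_point e N a b (Suc i)) (Inl (e i)) (Inr (e i))
    (a i) (b i) (tail_sum N a b (Suc i))"
proof
  show "tail_point e N a b (Suc i) $ Inl (e i) = 0" "tail_point e N a b (Suc i) $ Inr (e i) = 0"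
    "poisson_op e N a b (Suc i) y $ Inl (e i) = 0" "poisson_op e N a b (Suc i) y $ Inr (e i) = 0" for y
    unfolding tail_point_def poisson_op_def
    by (rule vec_sum_axis_zero, use map_sum_notin_labels[OF assms] in blast)+
  show "poisson_op e N a b (Suc i) y = poisson_op e N a b (Suc i) z"
    if "\<And>w. w \<noteq> Inl (e i) \<Longrightarrow> w \<noteq> Inr (e i) \<Longrightarrow> y $ w = z $ w" for y z
    unfolding poisson_op_def using map_sum_notin_labels[OF assms] that
    by (intro sum.cong refl arg_cong2[of _ _ _ _ axis]) auto
  show "tail_point e N a b i
      = tail_point e N a b (Suc i) + axis (Inl (e i)) (a i) + axis (Inr (e i)) (b i)"
    by (simp add: tail_point_def sum_labels[OF assms(2)] coord_def)
qed (simp_all add: poisson_op_linear poisson_op_Suc[OF assms(2)] poisson_op_skew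
    flip: vec.linear_add vec.linear_scale)

section \<open>The Hamiltonian distribution as the image of the Poisson matrix\<close>

lemma cpartial_linear: "cpartial w (\<lambda>q. \<Sum>v\<in>UNIV. c $ v * q $ v) p = c $ w"
proof -
  have "(\<Sum>v\<in>UNIV. c $ v * (p + z *s axis w 1) $ v) = (\<Sum>v\<in>UNIV. c $ v * p $ v) + c $ w * z" for z
  proof -
    have "bdot c (p + z *s axis w 1) = bdot c p + c $ w * z"
      by simp
    then show ?thesis
      unfolding bdot_def .
  qed
  then show ?thesis
    unfolding cpartial_def by (simp add: DERIV_imp_deriv)
qed

lemma cpartial_nth: "cpartial w (\<lambda>q. q $ v) p = (if w = v then 1 else 0)"
  using cpartial_linear[of w "axis v 1" p] 
  by (simp add: axis_def if_distrib[of "\<lambda>x. x * _"] cong: if_cong)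

lemma holomorphic_fun_linear: "holomorphic_fun (\<lambda>q. \<Sum>v\<in>UNIV. c $ v * q $ v)"
  unfolding holomorphic_fun_def
proof (intro allI exI conjI)
  show "Vector_Spaces.linear (*s) (*) (\<lambda>q. \<Sum>v\<in>UNIV. c $ v * q $ v)"
    by unfold_locales (simp_all add: algebra_simps sum.distrib sum_distrib_left)
  show "((\<lambda>q. \<Sum>v\<in>UNIV. c $ v * q $ v) has_derivative (\<lambda>q. \<Sum>v\<in>UNIV. c $ v * q $ v)) (at p)" for p
    by (intro bounded_linear_imp_has_derivative bounded_linear_sum bounded_linear_const_mult
        bounded_linear_vec_nth)
qed

text \<open>The field contracts the gradient with the first slot of the bracket,
  \<open>poisson_op\<close> with the second; antisymmetry gives the sign.\<close>

lemma hamiltonian_field_eq: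
  fixes e :: "nat \<Rightarrow> 'n::finite"
  shows "hamiltonian_field e f p = - poisson_op e CARD('n) (\<lambda>i. p $ Inl (e i)) (\<lambda>i. p $ Inr (e i)) 0
     (\<chi> w. cpartial w f p)"
proof -
  let ?B = "coord_bracket CARD('n) (\<lambda>i. p $ Inl (e i)) (\<lambda>i. p $ Inr (e i))"
  let ?W = "labels CARD('n) 0" and ?m = "map_sum e e"
  have "hamiltonian_field e f p $ v = - poisson_op e CARD('n) (\<lambda>i. p $ Inl (e i)) (\<lambda>i. p $ Inr (e i)) 0
     (\<chi> w. cpartial w f p) $ v" for v
  proof -
    have "hamiltonian_field e f p $ v
      = (\<Sum>u\<in>?W. \<Sum>w\<in>?W. ?B u w * cpartial (?m u) f p * (if ?m w = v then 1 else 0))"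
      by (simp add: hamiltonian_field_def poisson_bracket_def cpartial_nth labels_def
          lessThan_atLeast0)
    also have "\<dots> = (\<Sum>w\<in>?W. \<Sum>u\<in>?W. ?B u w * cpartial (?m u) f p * (if ?m w = v then 1 else 0))"
      by (rule sum.swap)
    also have "\<dots> = (\<Sum>w\<in>?W. - axis (?m w) (\<Sum>u\<in>?W. ?B w u * cpartial (?m u) f p) $ v)"
      by (intro sum.cong refl, subst coord_bracket_antisym)
        (auto simp: axis_def sum_negf)
    finally show ?thesis
      by (simp add: poisson_op_def sum_negf)
  qed
  then show ?thesis
    by (simp add: vec_eq_iff)
qed

text \<open>Linear functions are holomorphic and realize every vector as a gradient, so the whole
  image is attained.\<close>

lemma hamiltonian_distribution_eq:
  fixes e :: "nat \<Rightarrow> 'n::finite"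
  shows "hamiltonian_distribution e p
    = range (poisson_op e CARD('n) (\<lambda>i. p $ Inl (e i)) (\<lambda>i. p $ Inr (e i)) 0)" (is "_ = range ?A")
proof -
  interpret A: Vector_Spaces.linear "(*s)" "(*s)" ?A
    by (rule poisson_op_linear)
  have "hamiltonian_distribution e p \<subseteq> range ?A"
    by (auto simp: hamiltonian_distribution_def hamiltonian_field_eq simp flip: A.neg)
  moreover have "?A y \<in> hamiltonian_distribution e p" for y
  proof -
    have "?A y = hamiltonian_field e (\<lambda>q. \<Sum>v\<in>UNIV. (- y) $ v * q $ v) p"
      by (simp only: hamiltonian_field_eq cpartial_linear vec_nth_inverse A.neg minus_minus vec_lambda_eta)
    then show ?thesis
      unfolding hamiltonian_distribution_def using holomorphic_fun_linear by blast
  qed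
  ultimately show ?thesis
    by blast
qed

section \<open>Growth of the rank between the distinguished indices\<close>

lemma tail_sum_step: "i < N \<Longrightarrow> tail_sum N a b i = tail_sum N a b (Suc i) + a i * b i"
  by (simp add: tail_sum_def sum.atLeast_Suc_lessThan add.commute)

lemma num_nonzero_step:
  assumes "i < m"
  shows "num_nonzero a b {i..<m} = num_nonzero a b {Suc i..<m}
    + (if a i \<noteq> 0 then 1 else 0) + (if b i \<noteq> 0 then 1 else 0)"
proof -
  have "{j \<in> {i..<m}. f j \<noteq> 0}
      = (if f i \<noteq> 0 then insert i {j \<in> {Suc i..<m}. f j \<noteq> 0} else {j \<in> {Suc i..<m}. f j \<noteq> 0})"
    for f :: "nat \<Rightarrow> complex"
    using assms by (auto simp: not_less_eq_eq le_less Suc_le_eq)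
  then have "card {j \<in> {i..<m}. f j \<noteq> 0} = card {j \<in> {Suc i..<m}. f j \<noteq> 0} + (if f i \<noteq> 0 then 1 else 0)"
    for f :: "nat \<Rightarrow> complex"
    by simp
  then show ?thesis
    by (simp add: num_nonzero_def)
qed

locale poisson_tails =
  fixes e :: "nat \<Rightarrow> 'n::finite" and N :: nat and a b :: "nat \<Rightarrow> complex"
  assumes inj: "inj_on e {..<N}"
begin

abbreviation T :: "nat \<Rightarrow> complex" where "T \<equiv> tail_sum N a b"
abbreviation R :: "nat \<Rightarrow> nat" where "R i \<equiv> vec.dim (range (poisson_op e N a b i))"
abbreviation sol :: "nat \<Rightarrow> bool" where "sol i \<equiv> solvable (poisson_op e N a b i) (tail_point e N a b i)"
abbreviation obs :: "nat \<Rightarrow> bool" where "obs i \<equiv> obstructed (poisson_op e N a b i) (tail_point e N a b i)"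

lemma at_N: "R N = 0" "sol N" "T N = 0"
proof -
  have "poisson_op e N a b N = (\<lambda>_. 0)"
    by (simp add: poisson_op_def fun_eq_iff)
  then show "R N = 0"
    by simp
  show "sol N"
    by (simp add: solvable_def poisson_op_def tail_point_def)
  show "T N = 0"
    by (simp add: tail_sum_def)
qed

text \<open>Vanishing tail sums force \<open>a j * b j = 0\<close> for \<open>i \<le> j < m\<close>,
  so each index brings at most one non-zero coordinate. Such coordinates act in pairs: the first
  keeps the rank and creates an obstruction, the second raises the rank by 2 and removes it.\<close>

lemma zero_segment:
  assumes "i \<le> m" "m \<le> N" "sol m" "\<And>j. i \<le> j \<Longrightarrow> j \<le> m \<Longrightarrow> T j = 0"
  shows "R i = R m + 2 * (num_nonzero a b {i..<m} div 2)
    \<and> (if even (num_nonzero a b {i..<m}) then sol i else obs i)"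
  using assms(1,4)
proof (induction i rule: inc_induct)
  case base
  then show ?case
    using assms(3) by (simp add: num_nonzero_def)
next
  case (step i)
  have i: "i < N"
    using step.hyps assms(2) by simp
  interpret skew_extension "poisson_op e N a b i" "poisson_op e N a b (Suc i)"
    "tail_point e N a b i" "tail_point e N a b (Suc i)" "Inl (e i)" "Inr (e i)"
    "a i" "b i" "T (Suc i)"
    by (rule skew_extension_poisson_op[OF inj i])
  have T: "T (Suc i) = 0" "T i = 0"
    using step by auto
  have ab: "a i = 0 \<or> b i = 0"
    using T tail_sum_step[OF i, of a b] by simp
  have IH: "R (Suc i) = R m + 2 * (num_nonzero a b {Suc i..<m} div 2)"
    "if even (num_nonzero a b {Suc i..<m}) then sol (Suc i) else obs (Suc i)"
    using step by auto
  show ?case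
  proof (cases "a i = 0 \<and> b i = 0")
    case True
    then show ?thesis
      using IH trivial_step[OF T(1)] num_nonzero_step[OF \<open>i < m\<close>, of a b] by (auto split: if_splits)
  next
    case False
    then have "num_nonzero a b {i..<m} = Suc (num_nonzero a b {Suc i..<m})"
      using ab num_nonzero_step[OF \<open>i < m\<close>, of a b] by auto
    then show ?thesis
      using IH False ab dim_range_solvable[OF T(1)] obstructed_if_solvable[OF T(1)]
        dim_range_obstructed[OF T(1)] solvable_if_obstructed[OF T(1)]
      by (cases "even (num_nonzero a b {Suc i..<m})") (auto elim!: oddE)
  qed
qed

text \<open>At \<open>i\<close> the tail sum jumps away from zero, so both coordinates there are
  non-zero. Index \<open>i\<close> adds 2 to the rank iff an unpaired coordinate is left above it,
  which is the \<open>+ 1\<close> inside \<open>div\<close>.\<close>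

lemma zero_segment_end:
  assumes "i < m" "m \<le> N" "sol m" "\<And>j. i < j \<Longrightarrow> j \<le> m \<Longrightarrow> T j = 0" "T i \<noteq> 0"
  shows "R i = R m + 2 * ((num_nonzero a b {i<..<m} + 1) div 2)" "obs i"
proof -
  have i: "i < N"
    using assms by simp
  interpret skew_extension "poisson_op e N a b i" "poisson_op e N a b (Suc i)"
    "tail_point e N a b i" "tail_point e N a b (Suc i)" "Inl (e i)" "Inr (e i)"
    "a i" "b i" "T (Suc i)"
    by (rule skew_extension_poisson_op[OF inj i])
  have T: "T (Suc i) = 0"
    using assms by simp
  have ab: "a i \<noteq> 0" "b i \<noteq> 0"
    using T tail_sum_step[OF i, of a b] assms(5) by auto
  have IH: "R (Suc i) = R m + 2 * (num_nonzero a b {i<..<m} div 2)"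
    "if even (num_nonzero a b {i<..<m}) then sol (Suc i) else obs (Suc i)"
    using zero_segment[of "Suc i" m] assms by (auto simp: Suc_le_eq atLeastSucLessThan_greaterThanLessThan)
  show "R i = R m + 2 * ((num_nonzero a b {i<..<m} + 1) div 2)"
    using IH ab dim_range_solvable[OF T] dim_range_obstructed[OF T]
    by (cases "even (num_nonzero a b {i<..<m})") (auto elim!: oddE)
  show "obs i"
    using obstructed_both[OF T ab] .
qed

lemma nonzero_segment:
  assumes "i \<le> m" "m \<le> N" "obs m" "\<And>j. i \<le> j \<Longrightarrow> j \<le> m \<Longrightarrow> T j \<noteq> 0"
  shows "R i = R m + 2 * (m - i) \<and> obs i"
  using assms(1,4)
proof (induction i rule: inc_induct)
  case base
  then show ?case
    using assms(3) by simp
next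
  case (step i)
  have i: "i < N"
    using step.hyps assms(2) by simp
  interpret skew_extension "poisson_op e N a b i" "poisson_op e N a b (Suc i)"
    "tail_point e N a b i" "tail_point e N a b (Suc i)" "Inl (e i)" "Inr (e i)"
    "a i" "b i" "T (Suc i)"
    by (rule skew_extension_poisson_op[OF inj i])
  have T: "T (Suc i) \<noteq> 0" "T (Suc i) + a i * b i \<noteq> 0"
    using step tail_sum_step[OF i, of a b] by auto
  show ?case
    using step dim_range_nonzero[OF T(1)] obstructed_nonzero[OF T] by auto
qed

text \<open>The step to \<open>i\<close> still borders with the non-zero \<open>T (Suc i)\<close>,
  so \<open>i\<close> itself contributes 2 to the rank although \<open>T i = 0\<close>.\<close>

lemma nonzero_segment_end:
  assumes "i < m" "m \<le> N" "obs m" "\<And>j. i < j \<Longrightarrow> j \<le> m \<Longrightarrow> T j \<noteq> 0" "T i = 0"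
  shows "R i = R m + 2 * (m - i)" "sol i"
proof -
  have i: "i < N"
    using assms by simp
  interpret skew_extension "poisson_op e N a b i" "poisson_op e N a b (Suc i)"
    "tail_point e N a b i" "tail_point e N a b (Suc i)" "Inl (e i)" "Inr (e i)"
    "a i" "b i" "T (Suc i)"
    by (rule skew_extension_poisson_op[OF inj i])
  have T: "T (Suc i) \<noteq> 0" "T (Suc i) + a i * b i = 0"
    using assms tail_sum_step[OF i, of a b] by auto
  show "R i = R m + 2 * (m - i)" "sol i"
    using nonzero_segment[of "Suc i" m] assms dim_range_nonzero[OF T(1)] solvable_nonzero[OF T]
    by (auto simp: Suc_le_eq)
qed

end

section \<open>The sequence of distinguished indices\<close>

lemma biggest_Some:
  assumes "biggest A = Some m" "finite A"
  shows "m \<in> A" "j \<in> A \<Longrightarrow> j \<le> m"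
proof -
  have "A \<noteq> {}" "m = Max A"
    using assms by (simp_all add: biggest_def split: if_splits)
  with \<open>finite A\<close> show "m \<in> A" "j \<in> A \<Longrightarrow> j \<le> m"
    by auto
qed

lemma biggest_None: "biggest A = None \<longleftrightarrow> A = {}"
  by (simp add: biggest_def)

lemma index_opt_0_Some:
  assumes "index_opt N a b 0 = Some m"
  shows "m < N" "tail_sum N a b m \<noteq> 0" "m < j \<Longrightarrow> j \<le> N \<Longrightarrow> tail_sum N a b j = 0"
proof -
  have m: "m < N" "a m * b m \<noteq> 0" "\<And>j. j < N \<Longrightarrow> a j * b j \<noteq> 0 \<Longrightarrow> j \<le> m"
    using biggest_Some[of "{i. i < N \<and> a i * b i \<noteq> 0}" m] assms by auto
  have Z: "tail_sum N a b j = 0" if "m < j" for j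
    unfolding tail_sum_def using m(3) that by (intro sum.neutral ballI) (meson atLeastLessThan_iff leD order_trans)
  show "m < N" by fact
  show "tail_sum N a b m \<noteq> 0"
    using tail_sum_step[OF m(1), of a b] m(2) Z by simp
  show "m < j \<Longrightarrow> j \<le> N \<Longrightarrow> tail_sum N a b j = 0"
    by (rule Z)
qed

text \<open>By maximality of the next index, the tail sums strictly between two consecutive indices
  all vanish or are all non-zero, which is what the segment lemmas require.\<close>

lemma index_opt_Suc_Some:
  assumes "index_opt N a b k = Some m" "index_opt N a b (Suc k) = Some n"
  shows "n < m" "tail_sum N a b n = 0 \<longleftrightarrow> odd (Suc k)"
    "n < j \<Longrightarrow> j < m \<Longrightarrow> tail_sum N a b j = 0 \<longleftrightarrow> even (Suc k)"
proof -
  define A where "A = {i. i < m \<and> (tail_sum N a b i = 0 \<longleftrightarrow> odd (Suc k))}"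
  have "biggest A = Some n" "finite A"
    using assms by (simp_all add: A_def)
  from biggest_Some[OF this] have n: "n \<in> A" "\<And>j. j \<in> A \<Longrightarrow> j \<le> n"
    by blast+
  show "n < m" "tail_sum N a b n = 0 \<longleftrightarrow> odd (Suc k)"
    using n(1) by (auto simp: A_def)
  show "tail_sum N a b j = 0 \<longleftrightarrow> even (Suc k)" if "n < j" "j < m"
    using n(2)[of j] that by (auto simp: A_def)
qed

lemma index_opt_Suc_None:
  assumes "index_opt N a b k = Some m" "index_opt N a b (Suc k) = None" "j < m"
  shows "tail_sum N a b j = 0 \<longleftrightarrow> even (Suc k)"
  using assms by (auto simp: biggest_None)

text \<open>Bounds the number of steps by \<open>N\<close>, so that the \<open>GREATEST\<close> in
  \<open>last_step\<close> is attained.\<close>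

lemma index_opt_less: "index_opt N a b k = Some m \<Longrightarrow> m + k < N"
proof (induction k arbitrary: m)
  case 0
  then show ?case
    using index_opt_0_Some by simp
next
  case (Suc k)
  obtain n where n: "index_opt N a b k = Some n"
    using Suc.prems by (cases "index_opt N a b k") auto
  then show ?case
    using Suc.IH[OF n] index_opt_Suc_Some(1)[OF n Suc.prems] by simp
qed

lemma le_last_step: "index_opt N a b k = Some m \<Longrightarrow> k \<le> last_step N a b"
  unfolding last_step_def
  by (rule Greatest_le_nat[of _ _ N]) (auto dest!: index_opt_less)

lemma index_opt_last_step:
  assumes "i < N" "a i * b i \<noteq> 0"
  obtains m where "index_opt N a b (last_step N a b) = Some m"
    "index_opt N a b (Suc (last_step N a b)) = None"
proof -
  have "index_opt N a b 0 \<noteq> None"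
    using assms by (auto simp: biggest_None)
  then have "index_opt N a b (last_step N a b) \<noteq> None"
    unfolding last_step_def
    by (rule GreatestI_nat[of _ _ N]) (auto dest!: index_opt_less)
  moreover have "index_opt N a b (Suc (last_step N a b)) = None"
    using le_last_step[of N a b "Suc (last_step N a b)"] by (meson not_None_eq Suc_n_not_le_n)
  ultimately show ?thesis
    using that by blast
qed

section \<open>The rank along the distinguished indices\<close>

context poisson_tails
begin

text \<open>\<open>P\<close> collects the first \<open>k\<close> segments with non-zero tail sums,
  \<open>Q\<close> the first \<open>k\<close> segments with vanishing ones. As a vanishing segment
  comes first, \<open>Q\<close> runs one ahead of \<open>P\<close> at the even-numbered
  indices.\<close>

definition P :: "nat \<Rightarrow> int" where
  "P k = (\<Sum>j<k. 2 * (int (index N a b (2 * j)) - int (index N a b (2 * j + 1))))"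

definition Q :: "nat \<Rightarrow> int" where
  "Q k = (\<Sum>j<k. 2 * ((r_even N a b j + 1) div 2))"

lemma index_eq: "index_opt N a b k = Some m \<Longrightarrow> index N a b k = m"
  by (simp add: index_def)

lemma rank_odd_index:
  assumes m: "index_opt N a b (2 * k) = Some m" and n: "index_opt N a b (2 * k + 1) = Some n"
    and "int (R m) = P k + Q (Suc k)" "obs m" "T m \<noteq> 0"
  shows "int (R n) = P (Suc k) + Q (Suc k)" "sol n" "T n = 0"
proof -
  have n': "index_opt N a b (Suc (2 * k)) = Some n"
    using n by simp
  note * = index_opt_Suc_Some[OF m n']
  show "T n = 0"
    using * by simp
  have "T j \<noteq> 0" if "n < j" "j \<le> m" for j
    using *(3)[of j] that assms(5) by (cases "j = m") auto
  then have "R n = R m + 2 * (m - n)" "sol n"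
    using nonzero_segment_end[of n m] *(1) index_opt_less[OF m] assms(4) \<open>T n = 0\<close> by auto
  then show "int (R n) = P (Suc k) + Q (Suc k)" "sol n"
    using assms(3) *(1) index_eq[OF m] index_eq[OF n] by (auto simp: P_def of_nat_diff)
qed

lemma rank_even_index:
  assumes m: "index_opt N a b (2 * k + 1) = Some m" and n: "index_opt N a b (2 * k + 2) = Some n"
    and "int (R m) = P (Suc k) + Q (Suc k)" "sol m" "T m = 0"
  shows "int (R n) = P (Suc k) + Q (Suc (Suc k))" "obs n" "T n \<noteq> 0"
proof -
  have n': "index_opt N a b (Suc (2 * k + 1)) = Some n"
    using n by simp
  note * = index_opt_Suc_Some[OF m n']
  show "T n \<noteq> 0"
    using * by simp
  have "T j = 0" if "n < j" "j \<le> m" for j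
    using *(3)[of j] that assms(5) by (cases "j = m") auto
  then have "R n = R m + 2 * ((num_nonzero a b {n<..<m} + 1) div 2)" "obs n"
    using zero_segment_end[of n m] *(1) index_opt_less[OF m] assms(4) \<open>T n \<noteq> 0\<close> by auto
  \<comment> \<open>Existence of the index numbered \<open>2 * k + 2\<close> places it below
    \<open>last_step\<close>, which selects the branch of \<open>r_even\<close> without
    \<open>- 1\<close>.\<close>
  moreover have "r_even N a b (Suc k) = int (num_nonzero a b {n<..<m})"
    using le_last_step[OF n] index_eq[OF m] index_eq[OF n] by simp
  ultimately show "int (R n) = P (Suc k) + Q (Suc (Suc k))" "obs n"
    using assms(3) by (auto simp: Q_def zdiv_int)
qed

text \<open>Besides the rank, the induction carries the status of the point (\<open>obs\<close> or
  \<open>sol\<close>) and of the tail sum, which are the starting conditions of the next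
  segment.\<close>

lemma rank_at_index:
  "index_opt N a b (2 * k) = Some m \<Longrightarrow> int (R m) = P k + Q (Suc k) \<and> obs m \<and> T m \<noteq> 0"
  "index_opt N a b (2 * k + 1) = Some n \<Longrightarrow> int (R n) = P (Suc k) + Q (Suc k) \<and> sol n \<and> T n = 0"
proof (induction k arbitrary: m n)
  case 0
  {
    case 1
    then have m: "index_opt N a b 0 = Some m"
      by simp
    note * = index_opt_0_Some[OF m]
    have "R m = R N + 2 * ((num_nonzero a b {m<..<N} + 1) div 2)" "obs m"
      using zero_segment_end[of m N] * at_N by auto
    moreover have "r_even N a b 0 = int (num_nonzero a b {m<..<N})"
      using m index_eq[OF m] by (auto simp: biggest_def split: if_splits)
    ultimately show ?case
      using *(2) at_N by (simp add: P_def Q_def zdiv_int del: r_even.simps)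
  }
  note base = this
  {
    case 2
    then obtain m where m: "index_opt N a b (2 * 0) = Some m"
      by (cases "index_opt N a b 0") auto
    show ?case
      using base[OF m] rank_odd_index[OF m 2] by blast
  }
next
  case (Suc k)
  {
    case 1
    then obtain n where n: "index_opt N a b (2 * k + 1) = Some n"
      by (cases "index_opt N a b (2 * k + 1)") auto
    have m: "index_opt N a b (2 * k + 2) = Some m"
      using 1 by simp
    show ?case
      using Suc.IH(2)[OF n] rank_even_index[OF n m] by blast
  }
  note even = this
  {
    case 2
    then obtain m where m: "index_opt N a b (2 * Suc k) = Some m"
      by (cases "index_opt N a b (2 * Suc k)") auto
    show ?case
      using even[OF m] rank_odd_index[OF m 2] by blast
  }
qed

lemma rank_all_zero:
  assumes "\<forall>i<N. a i * b i = 0"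
  shows "int (R 0) = 2 * (r_even N a b 0 div 2)"
proof -
  have "T j = 0" for j
    unfolding tail_sum_def using assms by (intro sum.neutral) auto
  then show ?thesis
    using zero_segment[of 0 N] at_N assms by (simp add: lessThan_atLeast0 zdiv_int)
qed

lemma rank_last_even:
  assumes "i < N" "a i * b i \<noteq> 0" "last_step N a b = 2 * l"
  shows "int (R 0) = P (Suc l) + Q (Suc l)"
proof -
  obtain m where m: "index_opt N a b (2 * l) = Some m" "index_opt N a b (Suc (2 * l)) = None"
    using index_opt_last_step[of i N a b] assms by metis
  note * = rank_at_index(1)[OF m(1)]
  have "T j \<noteq> 0" if "j \<le> m" for j
    using index_opt_Suc_None[OF m, of j] that * by (cases "j = m") auto
  then have "R 0 = R m + 2 * m"
    using nonzero_segment[of 0 m] index_opt_less[OF m(1)] * by auto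
  \<comment> \<open>The default value \<open>0\<close> of the undefined index makes the last summand
    of \<open>P\<close> equal to the full remaining length \<open>m\<close>.\<close>
  moreover have "index N a b (2 * l + 1) = 0"
    using m(2) by (simp add: index_def)
  ultimately show ?thesis
    using * index_eq[OF m(1)] by (simp add: P_def)
qed

text \<open>The last vanishing segment runs down to index 0 and is not closed by an index with two
  non-zero coordinates, so it contributes through \<open>n div 2\<close> for its count
  \<open>n\<close>. The shift \<open>n - 1\<close> in \<open>r_even\<close> compensates the uniform
  \<open>+ 1\<close>.\<close>

lemma rank_last_odd:
  assumes "i < N" "a i * b i \<noteq> 0" "last_step N a b = 2 * l + 1"
  shows "int (R 0) = P (Suc l) + Q (Suc (Suc l))"
proof -
  obtain m where m: "index_opt N a b (2 * l + 1) = Some m" "index_opt N a b (Suc (2 * l + 1)) = None"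
    using index_opt_last_step[of i N a b] assms by metis
  note * = rank_at_index(2)[OF m(1)]
  have "T j = 0" if "j \<le> m" for j
    using index_opt_Suc_None[OF m, of j] that * by (cases "j = m") auto
  then have "R 0 = R m + 2 * (num_nonzero a b {..<m} div 2)"
    using zero_segment[of 0 m] index_opt_less[OF m(1)] * by (auto simp: lessThan_atLeast0)
  moreover have "r_even N a b (Suc l) = int (num_nonzero a b {..<m}) - 1"
    using assms(3) index_eq[OF m(1)] by simp
  ultimately show ?thesis
    using * by (simp add: Q_def zdiv_int)
qed

end

theorem proposition3p11:
  fixes e :: "nat \<Rightarrow> 'n::finite"
    and p :: "complex^('n + 'n)"
    and M :: "(complex^('n + 'n)) topology"
    and a b :: "nat \<Rightarrow> complex"
    and N s d :: nat
  assumes N: "N = CARD('n)"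
    and e: "bij_betw e {..<N} UNIV"
    and a: "\<And>i. a i = p $ Inl (e i)"
    and b: "\<And>i. b i = p $ Inr (e i)"
    and leaf: "symplectic_leaf e d M"
    and p: "p \<in> topspace M"
    and s: "s = last_step N a b"
  shows "((\<forall>i<N. a i * b i = 0) \<longrightarrow> int d = 2 * (r_even N a b 0 div 2)) \<and>
    ((\<exists>i<N. a i * b i \<noteq> 0) \<longrightarrow>
      (\<forall>l. s = 2 * l \<longrightarrow>
        int d = (\<Sum>k=0..l. 2 * (int (index N a b (2 * k)) - int (index N a b (2 * k + 1)))
                            + 2 * ((r_even N a b k + 1) div 2))) \<and>
      (\<forall>l. s = 2 * l + 1 \<longrightarrow>
        int d = (\<Sum>k=0..l. 2 * (int (index N a b (2 * k)) - int (index N a b (2 * k + 1))))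
              + (\<Sum>k=0..l+1. 2 * ((r_even N a b k + 1) div 2))))"
proof -
  interpret poisson_tails e N a b
    using e by unfold_locales (simp add: bij_betw_def)
  have "is_tangent_space d M p (hamiltonian_distribution e p)"
    using leaf p by (simp add: symplectic_leaf_def connected_integral_manifold_def)
  moreover have "a = (\<lambda>i. p $ Inl (e i))" "b = (\<lambda>i. p $ Inr (e i))"
    using a b by auto
  \<comment> \<open>The tangent space of the leaf at \<open>p\<close> is the Hamiltonian
    distribution there, hence the image of the full Poisson matrix.\<close>
  ultimately have d: "d = R 0"
    using dim_tangent_space hamiltonian_distribution_eq[of e p] N by metis
  have "{0..l} = {..<Suc l}" for l :: nat
    by auto
  then show ?thesis
    using rank_all_zero rank_last_even rank_last_odd unfolding d s P_def Q_def
    by (auto simp: sum.distrib simp del: r_even.simps sum.lessThan_Suc)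
qed

end
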